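(* For a positive integer $m$, the graph $A(2m)$ is a tree (i.e. its underlying undirected graph contains no cycle) if and only if $m=2^t-\epsilon$ for some $(t,\epsilon)\in\mathbb{N}\times\{0,1\}$.
   Context: $\mathbb{N}=\{1,2,3,\dots\}$. A hyperbinary expansion of a positive integer $n$ is a word $x_1\cdots x_k$ over the alphabet $\{0,1,2\}$ with $x_1\neq 0$ and $n=\sum_{i=1}^k x_i2^{k-i}$; $\mathcal H(n)$ denotes the set of hyperbinary expansions of $n$. Words are regarded up to leading zeros. Single-step reductions are: (I) $2\vec y \to 1\,0\,\vec y$; (II) $\vec x\,0\,2\,\vec y\to \vec x\,1\,0\,\vec y$; (III) $\vec x\,1\,2\,\vec y \twoheadrightarrow \vec x\,2\,0\,\vec y$, for words $\vec x,\vec y$ over $\{0,1,2\}$. If $\vec u$ is transformed into $\vec v$ by one single-step reduction, $\vec v$ is a child of $\vec u$. $A(n)$ is the directed graph with vertex set $\mathcal H(n)$ and an arc from $\vec u$ to $\vec v$ iff $\vec v$ is a child of $\vec u$. *)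

theory Defs
  imports "Graph_Theory.Graph_Theory"
begin

text \<open>Words over the digits 0, 1, 2 are lists of natural numbers, most significant digit first.\<close>

definition word_value :: "nat list \<Rightarrow> nat" where
  "word_value x = (\<Sum>i = 1..length x. x ! (i - 1) * 2 ^ (length x - i))"

definition hyperbinary_expansions :: "nat \<Rightarrow> nat list set" where
  "hyperbinary_expansions n =
     {x. x \<noteq> [] \<and> set x \<subseteq> {0, 1, 2} \<and> hd x \<noteq> 0 \<and> n = word_value x}"

text \<open>
  Identifying words that differ only in leading zeros, every class of nonzero value has a unique
  representative with nonzero leading digit. On these representatives rule (I) is
  what rule (II) becomes when the digit 0 it rewrites is a suppressed leading zero.
\<close>

inductive child :: "nat list \<Rightarrow> nat list \<Rightarrow> bool" where
  I: "child (2 # y) (1 # 0 # y)"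
| II: "child (x @ 0 # 2 # y) (x @ 1 # 0 # y)"
| III: "child (x @ 1 # 2 # y) (x @ 2 # 0 # y)"

definition hyperbinary_graph :: "nat \<Rightarrow> nat list pair_pre_digraph" where
  "hyperbinary_graph n =
     \<lparr> pverts = hyperbinary_expansions n,
       parcs = {(u, v). u \<in> hyperbinary_expansions n \<and> v \<in> hyperbinary_expansions n \<and> child u v} \<rparr>"

text \<open>
  The constants \<open>forest\<close> and \<open>tree\<close> of the library only exclude directed
  cycles, and on a symmetric digraph they count \<open>a, b, a\<close> as a cycle, so neither expresses
  acyclicity of the underlying undirected graph. A cycle of that simple graph is a cycle
  of the symmetric closure with at least three vertices.
\<close>

definition underlying_cycle :: "('a, 'b) pre_digraph \<Rightarrow> ('a \<times> 'a) awalk \<Rightarrow> bool" where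
  "underlying_cycle G p \<longleftrightarrow> pre_digraph.cycle (with_proj (mk_symmetric G)) p \<and> 3 \<le> length p"

text \<open>
  Connectedness is not part of the definition: a tree is here a digraph whose underlying
  undirected graph contains no cycle.
\<close>

definition is_tree :: "('a, 'b) pre_digraph \<Rightarrow> bool" where
  "is_tree G \<longleftrightarrow> (\<nexists>p. underlying_cycle G p)"

end

theory Submission
  imports Defs
begin

text \<open>
  Every reduction lowers the digit sum by one, so an undirected cycle has a vertex of maximal digit
  sum and its two neighbours there are distinct children of it. If \<open>m\<close> is \<open>2 ^ t\<close> or
  \<open>2 ^ t - 1\<close>, every expansion of \<open>2 * m\<close> has the shape \<open>1\<dots>1 2 0\<dots>0\<close> or \<open>1 0\<dots>0\<close>,
  respectively \<open>1\<dots>1 0 2\<dots>2\<close> or \<open>2\<dots>2\<close> (runs may be empty), and none of these words has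
  two children.

  Conversely, if an expansion contains two disjoint blocks \<open>a 0\<close> with \<open>a \<in> {1, 2}\<close>, then
  reverting the reductions at these two blocks independently gives a cycle of length four. Two such
  blocks exist in the binary expansion of \<open>n\<close> unless it is \<open>1\<dots>1 0\<dots>0\<close> or
  \<open>1\<dots>1 0\<dots>0 1\<dots>1\<close>. The latter is odd, and \<open>1\<dots>1 1 1 0 0 0\<dots>0\<close> can be replaced by
  \<open>1\<dots>1 1 0 2 0 0\<dots>0\<close>.
\<close>

section \<open>Word values\<close>

lemma word_value_Nil [simp]: "word_value [] = 0"
  by (simp add: word_value_def)

lemma word_value_snoc [simp]: "word_value (x @ [d]) = 2 * word_value x + d"
proof -
  have "(\<Sum>i = 1..length x. (x @ [d]) ! (i - 1) * 2 ^ (Suc (length x) - i))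
      = (\<Sum>i = 1..length x. 2 * (x ! (i - 1) * 2 ^ (length x - i)))"
    by (rule sum.cong) (auto simp: nth_append Suc_diff_le)
  then show ?thesis
    by (simp add: word_value_def sum_distrib_left)
qed

lemma word_value_append: "word_value (x @ y) = word_value x * 2 ^ length y + word_value y"
proof (induction y rule: rev_induct)
  case (snoc d y)
  then show ?case
    using word_value_snoc[of "x @ y" d] by (simp add: algebra_simps)
qed simp

lemma word_value_Cons: "word_value (d # y) = d * 2 ^ length y + word_value y"
  using word_value_append[of "[d]" y] word_value_snoc[of "[]" d] by simp

lemma word_value_replicate_0 [simp]: "word_value (replicate b 0) = 0"
  by (induction b) (simp_all add: word_value_Cons)

lemma word_value_replicate_1: "word_value (replicate a 1) = 2 ^ a - 1"
  by (induction a) (simp_all add: word_value_Cons)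

text \<open>Every rule is a carry: a 2 at weight 2^j is cleared and one unit is added at weight
  2^(j+1).\<close>

lemma child_word_value: "child u v \<Longrightarrow> word_value u = word_value v"
  by (induction rule: child.induct) (auto simp: word_value_append word_value_Cons algebra_simps)

lemma child_digit_sum: "child u v \<Longrightarrow> sum_list u = Suc (sum_list v)"
  by (induction rule: child.induct) auto

section \<open>Acyclicity\<close>

text \<open>\<open>f\<close> is a potential. At a vertex of an undirected cycle where
  \<open>f\<close> is maximal, both cycle edges must be arcs leaving it. Since the cycle has at
  least three vertices, these arcs have different heads, against \<open>unique\<close>.\<close>

lemma is_treeI:
  fixes f :: "'a \<Rightarrow> nat"
  assumes less: "\<And>e. e \<in> arcs G \<Longrightarrow> f (head G e) < f (tail G e)"
    and unique: "\<And>e e'. e \<in> arcs G \<Longrightarrow> e' \<in> arcs G \<Longrightarrow> tail G e = tail G e' \<Longrightarrow> head G e = head G e'"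
  shows "is_tree G"
  unfolding is_tree_def
proof
  assume "\<exists>p. underlying_cycle G p"
  then obtain p where p: "pre_digraph.cycle (with_proj (mk_symmetric G)) p" "3 \<le> length p"
    by (auto simp: underlying_cycle_def)
  define n where "n = length p"
  obtain u where aw: "pre_digraph.awalk (with_proj (mk_symmetric G)) u p u"
    and dist: "distinct (tl (pre_digraph.awalk_verts (with_proj (mk_symmetric G)) u p))"
    using p(1) unfolding pre_digraph.cycle_def by blast
  have sub: "set p \<subseteq> parcs (mk_symmetric G)"
    and cas: "pre_digraph.cas (with_proj (mk_symmetric G)) u p u"
    using aw unfolding pre_digraph.awalk_def by auto
  have dsnd: "distinct (map snd p)"
    using dist p(2) unfolding pre_digraph.awalk_verts_conv'[OF cas] by (auto split: if_splits)
  \<comment> \<open>The recursive predicate \<open>cas\<close> is restated by index. The end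
    conditions belong to the induction: the start condition for \<open>es\<close> supplies the link
    at \<open>i = 0\<close>.\<close>
  have cas_step: "(Suc i < length q \<longrightarrow> snd (q ! i) = fst (q ! Suc i)) \<and> fst (q ! 0) = a \<and>
      snd (q ! (length q - 1)) = b"
    if "pre_digraph.cas (with_proj (mk_symmetric G)) a q b" "q \<noteq> []" for a b q i
    using that
  proof (induction q arbitrary: a i)
    case (Cons e es)
    have *: "pre_digraph.cas (with_proj (mk_symmetric G)) (snd e) es b" "fst e = a"
      using Cons.prems(1) by (auto simp: pre_digraph.cas.simps)
    show ?case
    proof (cases "es = []")
      case True
      then show ?thesis using * by (simp add: pre_digraph.cas.simps)
    next
      case False
      show ?thesis
        using Cons.IH[OF *(1) False, of "i - 1"] Cons.IH[OF *(1) False, of 0] *(2) False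
        by (cases i) auto
    qed
  qed simp
  have n: "3 \<le> n" "p \<noteq> []" using p(2) by (auto simp: n_def)
  \<comment> \<open>From here on the vertices of the cycle are the heads \<open>snd (p ! i)\<close>,
    which are distinct, with indices read modulo \<open>n\<close>.\<close>
  have next_arc: "snd (p ! i) = fst (p ! (Suc i mod n))" if "i < n" for i
  proof (cases "Suc i = n")
    case True
    then have "i = length p - 1" by (simp add: n_def)
    then have "snd (p ! i) = u" using cas_step[OF cas n(2)] by blast
    then show ?thesis using cas_step[OF cas n(2)] True by simp
  next
    case False
    then show ?thesis using cas_step[OF cas n(2), of i] that by (simp add: n_def)
  qed
  have fin: "finite ((\<lambda>i. f (snd (p ! i))) ` {..<n})" "(\<lambda>i. f (snd (p ! i))) ` {..<n} \<noteq> {}"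
    using n(1) by (auto simp: lessThan_empty_iff)
  from Max_in[OF fin] obtain i where
    i: "i < n" "f (snd (p ! i)) = Max ((\<lambda>i. f (snd (p ! i))) ` {..<n})"
    by auto
  have max: "f (snd (p ! k)) \<le> f (snd (p ! i))" if "k < n" for k
    using Max_ge[OF fin(1)] that unfolding i(2) by blast
  \<comment> \<open>\<open>j\<close> and \<open>k\<close> are the cyclic successor and predecessor
    of \<open>i\<close>; adding \<open>n\<close> first keeps the subtraction from truncating at
    \<open>i = 0\<close>. They differ because \<open>n\<close> is at least 3.\<close>
  define j where "j = Suc i mod n"
  define k where "k = (i + n - 1) mod n"
  have jk: "j < n" "k < n" "Suc k mod n = i"
    using n(1) i(1) by (auto simp: j_def k_def mod_Suc_eq)
  have "j \<noteq> k"
    using n(1) i(1) by (cases "i = 0"; cases "Suc i = n") (auto simp: j_def k_def mod_if)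
  then have ne: "snd (p ! j) \<noteq> snd (p ! k)"
    using dsnd jk(1,2) by (auto simp: distinct_conv_nth n_def)
  \<comment> \<open>An edge of the symmetric closure comes from an arc in one of the two directions;
    an arc into the maximal vertex would have a tail with larger \<open>f\<close>.\<close>
  have neighbour: "\<exists>e\<in>arcs G. tail G e = snd (p ! i) \<and> head G e = snd (p ! l)"
    if "l < n" "(snd (p ! i), snd (p ! l)) \<in> parcs (mk_symmetric G)" for l
    using that(2) max[OF that(1)] less unfolding parcs_mk_symmetric by fastforce
  have "(snd (p ! i), snd (p ! j)) \<in> parcs (mk_symmetric G)"
    using sub jk(1) next_arc[OF i(1)] nth_mem[of j p] by (auto simp: n_def j_def)
  moreover have "(snd (p ! k), snd (p ! i)) \<in> parcs (mk_symmetric G)"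
    using sub i(1) next_arc[OF jk(2)] jk(3) nth_mem[of i p] by (auto simp: n_def)
  then have "(snd (p ! i), snd (p ! k)) \<in> parcs (mk_symmetric G)"
    unfolding parcs_mk_symmetric by auto
  ultimately show False
    using neighbour[OF jk(1)] neighbour[OF jk(2)] unique ne by metis
qed

section \<open>Words with at most one child\<close>

text \<open>Rules II and III act alike: the digit before the 2 goes up by one and the 2 becomes 0.
  Hence the position \<open>i\<close> of the rewritten 2 determines the child.\<close>

lemma child_at:
  assumes "child u v" "u \<noteq> []" "hd u \<noteq> 0"
  obtains i where "i < length u" "u ! i = 2" "i = 0 \<or> u ! (i - 1) \<noteq> 2"
    "v = (if i = 0 then 1 # 0 # tl u else take (i - 1) u @ Suc (u ! (i - 1)) # 0 # drop (Suc i) u)"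
  using assms(1)
proof cases
  case (I y)
  then show ?thesis using that[of 0] by simp
next
  case (II x y)
  then show ?thesis using that[of "Suc (length x)"] by (simp add: nth_append)
next
  case (III x y)
  then show ?thesis using that[of "Suc (length x)"] by (simp add: nth_append)
qed

lemma child_unique:
  assumes "child u v" "child u v'" "u \<noteq> []" "hd u \<noteq> 0"
    and pos: "\<And>i. i < length u \<Longrightarrow> u ! i = 2 \<Longrightarrow> i = 0 \<or> u ! (i - 1) \<noteq> 2 \<Longrightarrow> i = c"
  shows "v = v'"
  using child_at[OF assms(1,3,4)] child_at[OF assms(2,3,4)] pos by metis

text \<open>A rule can only rewrite a 2 that starts a run of 2s. If each word has at most one such
  position, it has at most one child, and the digit sum serves as potential.\<close>

lemma is_tree_hyperbinaryI:
  assumes "\<And>u. u \<in> hyperbinary_expansions n \<Longrightarrow>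
    \<exists>c. \<forall>i < length u. u ! i = 2 \<longrightarrow> i = 0 \<or> u ! (i - 1) \<noteq> 2 \<longrightarrow> i = c"
  shows "is_tree (with_proj (hyperbinary_graph n))"
proof (rule is_treeI[where f = sum_list])
  fix e assume "e \<in> arcs (with_proj (hyperbinary_graph n))"
  then show "sum_list (head (with_proj (hyperbinary_graph n)) e)
      < sum_list (tail (with_proj (hyperbinary_graph n)) e)"
    using child_digit_sum by (fastforce simp: hyperbinary_graph_def)
next
  fix e e' :: "nat list \<times> nat list"
  assume "e \<in> arcs (with_proj (hyperbinary_graph n))" "e' \<in> arcs (with_proj (hyperbinary_graph n))"
    "tail (with_proj (hyperbinary_graph n)) e = tail (with_proj (hyperbinary_graph n)) e'"
  then have *: "fst e \<in> hyperbinary_expansions n" "child (fst e) (snd e)" "child (fst e) (snd e')"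
    by (auto simp: hyperbinary_graph_def)
  obtain c where "\<forall>i < length (fst e). fst e ! i = 2 \<longrightarrow> i = 0 \<or> fst e ! (i - 1) \<noteq> 2 \<longrightarrow> i = c"
    using assms[OF *(1)] by blast
  then have "snd e = snd e'"
    using child_unique[OF *(2,3), of c] *(1) by (auto simp: hyperbinary_expansions_def)
  then show "head (with_proj (hyperbinary_graph n)) e = head (with_proj (hyperbinary_graph n)) e'"
    by simp
qed

section \<open>Expansions of powers of two, and of these minus one or two\<close>

lemma word_value_pos: "x \<noteq> [] \<Longrightarrow> hd x \<noteq> 0 \<Longrightarrow> word_value x > 0"
  by (cases x) (auto simp: word_value_Cons)

text \<open>For positive \<open>k\<close> the value is odd, so the last digit is 1 and the remaining
  word has value \<open>2 ^ (k - 1) - 1\<close>. The leading digit condition is conditional so that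
  the induction can end at the empty word.\<close>

lemma expansion_pow2_minus_1:
  assumes "set x \<subseteq> {0, 1, 2}" "x \<noteq> [] \<Longrightarrow> hd x \<noteq> 0" "word_value x = 2 ^ k - 1"
  shows "x = replicate k 1"
  using assms
proof (induction x arbitrary: k rule: rev_induct)
  case Nil
  have "k = 0"
    using Nil.prems(3) one_less_power[of "2::nat" k] by (cases k) auto
  then show ?case by simp
next
  case (snoc d x)
  have "0 < word_value (x @ [d])"
    using snoc.prems(2) by (intro word_value_pos) auto
  then have "k \<noteq> 0"
    using snoc.prems(3) by (intro notI) simp
  then obtain k' where k: "k = Suc k'"
    using not0_implies_Suc by blast
  have d: "d \<in> {0, 1, 2}" using snoc.prems(1) by simp
  have eq: "2 * word_value x + d = 2 * 2 ^ k' - 1"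
    using snoc.prems(3) k by simp
  have "1 \<le> (2::nat) ^ k'" by simp
  then have "d = 1 \<and> word_value x = 2 ^ k' - 1"
    using eq d by (elim insertE emptyE; presburger)
  moreover have "x \<noteq> [] \<Longrightarrow> hd x \<noteq> 0"
    using snoc.prems(2) by simp
  ultimately have "d = 1" "x = replicate k' 1"
    using snoc.IH[of k'] snoc.prems(1) by auto
  then show ?case
    by (simp add: k replicate_append_same)
qed

text \<open>A last digit 0 leaves the previous power of two; a last digit 2 leaves that power minus
  one, whose expansion is unique.\<close>

lemma expansion_pow2:
  assumes "set x \<subseteq> {0, 1, 2}" "x \<noteq> []" "hd x \<noteq> 0" "word_value x = 2 ^ k"
  shows "(\<exists>b. x = 1 # replicate b 0) \<or> (\<exists>a b. x = replicate a 1 @ 2 # replicate b 0)"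
  using assms
proof (induction x arbitrary: k rule: rev_induct)
  case (snoc d x)
  have d: "d \<in> {0, 1, 2}" using snoc.prems(1) by simp
  show ?case
  proof (cases "x = []")
    case True
    then have "d = 1 \<or> d = 2" using d snoc.prems(3) by auto
    then show ?thesis
      using True by (metis append_Nil replicate_0)
  next
    case False
    then have hd: "hd x \<noteq> 0" using snoc.prems(3) by simp
    have pos: "word_value x > 0" using word_value_pos[OF False hd] .
    have eq: "2 * word_value x + d = 2 ^ k" using snoc.prems(4) by simp
    have "k \<noteq> 0" using eq pos by (intro notI) simp
    then obtain k' where k: "k = Suc k'"
      using not0_implies_Suc by blast
    have "d = 0 \<and> word_value x = 2 ^ k' \<or> d = 2 \<and> word_value x = 2 ^ k' - 1"
      using eq d unfolding k power_Suc by (elim insertE emptyE; presburger)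
    then show ?thesis
    proof
      assume *: "d = 0 \<and> word_value x = 2 ^ k'"
      have "(\<exists>b. x = 1 # replicate b 0) \<or> (\<exists>a b. x = replicate a 1 @ 2 # replicate b 0)"
        using snoc.IH[of k'] snoc.prems(1) False hd * by simp
      then show ?thesis
        using * by (metis append_Cons append_assoc replicate_Suc replicate_append_same)
    next
      assume *: "d = 2 \<and> word_value x = 2 ^ k' - 1"
      then have "x = replicate k' 1"
        using snoc.prems(1) hd by (intro expansion_pow2_minus_1) auto
      then show ?thesis
        using * by (metis replicate_0)
    qed
  qed
qed simp

text \<open>A last digit 2 leaves \<open>2 ^ k - 2\<close>, to which the induction applies; a last
  digit 0 leaves \<open>2 ^ k - 1\<close>, which forces all ones. With exponent
  \<open>Suc k\<close>, the case \<open>k = 0\<close> is the empty word.\<close>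

lemma expansion_pow2_minus_2:
  assumes "set x \<subseteq> {0, 1, 2}" "x \<noteq> [] \<Longrightarrow> hd x \<noteq> 0" "word_value x = 2 ^ Suc k - 2"
  shows "(\<exists>b. x = replicate b 2) \<or> (\<exists>a b. x = replicate a 1 @ 0 # replicate b 2)"
  using assms
proof (induction x arbitrary: k rule: rev_induct)
  case Nil
  then show ?case by (metis replicate_0)
next
  case (snoc d x)
  have d: "d \<in> {0, 1, 2}" using snoc.prems(1) by simp
  have hd: "x \<noteq> [] \<Longrightarrow> hd x \<noteq> 0" using snoc.prems(2) by simp
  have "0 < word_value (x @ [d])"
    using snoc.prems(2) by (intro word_value_pos) auto
  then have "k \<noteq> 0"
    using snoc.prems(3) by (intro notI) simp
  then obtain k' where k: "k = Suc k'"
    using not0_implies_Suc by blast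
  have eq: "2 * word_value x + d = 2 * (2 * 2 ^ k') - 2"
    using snoc.prems(3) k by simp
  have "1 \<le> (2::nat) ^ k'" by simp
  then have "d = 0 \<and> word_value x = 2 * 2 ^ k' - 1 \<or> d = 2 \<and> word_value x = 2 * 2 ^ k' - 2"
    using eq d by (elim insertE emptyE; presburger)
  then show ?case
  proof
    assume *: "d = 0 \<and> word_value x = 2 * 2 ^ k' - 1"
    then have "x = replicate k 1"
      using snoc.prems(1) hd k by (intro expansion_pow2_minus_1) auto
    then show ?thesis
      using * by (metis replicate_0)
  next
    assume *: "d = 2 \<and> word_value x = 2 * 2 ^ k' - 2"
    then have "(\<exists>b. x = replicate b 2) \<or> (\<exists>a b. x = replicate a 1 @ 0 # replicate b 2)"
      using snoc.IH[of k'] snoc.prems(1) hd by simp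
    then show ?thesis
      using * by (metis append_Cons append_assoc replicate_Suc replicate_append_same)
  qed
qed

lemma is_tree_pow2: "is_tree (with_proj (hyperbinary_graph (2 ^ k)))"
proof (rule is_tree_hyperbinaryI)
  fix u assume "u \<in> hyperbinary_expansions (2 ^ k)"
  then have "(\<exists>b. u = 1 # replicate b 0) \<or> (\<exists>a b. u = replicate a 1 @ 2 # replicate b 0)"
    using expansion_pow2[of u k] by (auto simp: hyperbinary_expansions_def)
  then show "\<exists>c. \<forall>i<length u. u ! i = 2 \<longrightarrow> i = 0 \<or> u ! (i - 1) \<noteq> 2 \<longrightarrow> i = c"
  proof (elim disjE exE)
    fix a b assume u: "u = replicate a 1 @ 2 # replicate b 0"
    have "i = a" if "i < length u" "u ! i = 2" for i
      using that unfolding u by (auto simp: nth_append nth_Cons' split: if_splits)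
    then show ?thesis by blast
  next
    fix b assume u: "u = 1 # replicate b 0"
    have "i = 0" if "i < length u" "u ! i = 2" for i
      using that unfolding u by (auto simp: nth_Cons' split: if_splits)
    then show ?thesis by blast
  qed
qed

lemma is_tree_pow2_minus_2: "is_tree (with_proj (hyperbinary_graph (2 ^ Suc k - 2)))"
proof (rule is_tree_hyperbinaryI)
  fix u assume "u \<in> hyperbinary_expansions (2 ^ Suc k - 2)"
  then have "(\<exists>b. u = replicate b 2) \<or> (\<exists>a b. u = replicate a 1 @ 0 # replicate b 2)"
    using expansion_pow2_minus_2[of u k] by (auto simp: hyperbinary_expansions_def)
  then show "\<exists>c. \<forall>i<length u. u ! i = 2 \<longrightarrow> i = 0 \<or> u ! (i - 1) \<noteq> 2 \<longrightarrow> i = c"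
  proof (elim disjE exE)
    fix b assume u: "u = replicate b 2"
    have "i = 0" if "i < length u" "i = 0 \<or> u ! (i - 1) \<noteq> 2" for i
      using that unfolding u by (auto split: if_splits)
    then show ?thesis by blast
  next
    fix a b assume u: "u = replicate a 1 @ 0 # replicate b 2"
    \<comment> \<open>The only 2 not preceded by another 2 stands right after the 0, which has index
      \<open>a\<close>.\<close>
    have "i = Suc a" if "i < length u" "u ! i = 2" "i = 0 \<or> u ! (i - 1) \<noteq> 2" for i
    proof (rule ccontr)
      assume "i \<noteq> Suc a"
      moreover have "i > a"
        using that(2) unfolding u by (auto simp: nth_append nth_Cons' split: if_splits)
      ultimately show False
        using that(1,3) unfolding u by (auto simp: nth_append nth_Cons' split: if_splits)
    qed
    then show ?thesis by blast
  qed
qed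

section \<open>Cycles of length four\<close>

text \<open>The prefix becomes \<open>p @ [a - 1, 2]\<close>, except that an empty \<open>p\<close>
  with \<open>a = 1\<close> would then start with 0; there rule I is reverted. One \<open>p'\<close>
  must serve every continuation \<open>q\<close>, so that this block can be reverted independently
  of a later one.\<close>

lemma revert_reduction:
  assumes "a \<in> {1, 2}" "p \<noteq> [] \<Longrightarrow> hd p \<noteq> 0" "set p \<subseteq> {0, 1, 2}"
  obtains p' where "p' \<noteq> []" "hd p' \<noteq> 0" "set p' \<subseteq> {0, 1, 2}"
    "\<And>q. child (p' @ q) (p @ [a, 0] @ q)"
proof (cases "p = [] \<and> a = 1")
  case True
  then show ?thesis
    using that[of "[2]"] child.I by auto
next
  case False
  have "child ((p @ [a - 1, 2]) @ q) (p @ [a, 0] @ q)" for q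
    using assms(1) child.II[of p q] child.III[of p q] by auto
  then show ?thesis
    using that[of "p @ [a - 1, 2]"] assms False by (cases p) auto
qed

text \<open>A block \<open>[a, 0]\<close> with these values of \<open>a\<close> is what a reduction
  leaves behind, so it is a place where one can be undone.\<close>

definition two_blocks :: "nat list \<Rightarrow> bool" where
  "two_blocks x \<longleftrightarrow> (\<exists>p a q b r. a \<in> {1, 2} \<and> b \<in> {1, 2} \<and> x = p @ [a, 0] @ q @ [b, 0] @ r)"

lemma two_blocks_append: "two_blocks x \<Longrightarrow> two_blocks (x @ y)"
  unfolding two_blocks_def by (metis append.assoc)

lemma two_blocks_not_tree:
  assumes x: "x \<in> hyperbinary_expansions n" and "two_blocks x"
  shows "\<not> is_tree (with_proj (hyperbinary_graph n))"
proof -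
  obtain p a q b r where ab: "a \<in> {1, 2}" "b \<in> {1, 2}" and xeq: "x = p @ [a, 0] @ q @ [b, 0] @ r"
    using assms(2) unfolding two_blocks_def by blast
  have xs: "set x \<subseteq> {0, 1, 2}" "hd x \<noteq> 0" "word_value x = n"
    using x by (auto simp: hyperbinary_expansions_def)
  have p: "p \<noteq> [] \<Longrightarrow> hd p \<noteq> 0" "set p \<subseteq> {0, 1, 2}"
    using xs(1,2) unfolding xeq by auto
  obtain p' where p': "p' \<noteq> []" "hd p' \<noteq> 0" "set p' \<subseteq> {0, 1, 2}"
    "\<And>q. child (p' @ q) (p @ [a, 0] @ q)"
    using revert_reduction[OF ab(1) p] by blast
  \<comment> \<open>Both blocks of \<open>x\<close> are reduced; \<open>z\<close> reverts the
    second, \<open>y\<close> the first and \<open>w\<close> both. The square is \<open>w\<close> to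
    \<open>z\<close> to \<open>x\<close> and \<open>w\<close> to \<open>y\<close> to
    \<open>x\<close>. As \<open>P\<close> is nonempty, the second block never needs rule I.\<close>
  define P where "P = p @ [a, 0] @ q"
  define z where "z = P @ [b - 1, 2] @ r"
  define y where "y = p' @ q @ [b, 0] @ r"
  define w where "w = p' @ q @ [b - 1, 2] @ r"
  have P: "P \<noteq> []" "hd P \<noteq> 0" "set P \<subseteq> {0, 1, 2}"
    using xs(1,2) unfolding xeq P_def by (auto simp: hd_append)
  have zx: "child z x"
    using ab(2) child.II[of P r] child.III[of P r] unfolding z_def xeq P_def by auto
  have yx: "child y x" unfolding y_def xeq using p'(4) by simp
  have wz: "child w z" unfolding w_def z_def P_def using p'(4)[of "q @ [b - 1, 2] @ r"] by simp
  have wy: "child w y"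
    using ab(2) child.II[of "p' @ q" r] child.III[of "p' @ q" r] unfolding w_def y_def by auto
  \<comment> \<open>Just before the common suffix \<open>r\<close> stands a 2 in \<open>z\<close>
    and a 0 in \<open>y\<close>.\<close>
  have zy: "z \<noteq> y"
  proof
    assume "z = y"
    then have "word_value z = word_value y" "drop (length z - Suc (length r)) z = drop (length y - Suc (length r)) y"
      by simp_all
    then show False by (simp add: z_def y_def)
  qed
  have val: "word_value z = n" "word_value y = n" "word_value w = n"
    using child_word_value[OF zx] child_word_value[OF yx] child_word_value[OF wz] xs(3) by simp_all
  have r: "set r \<subseteq> {0, 1, 2}" "set q \<subseteq> {0, 1, 2}" using xs(1) xeq by auto
  have in_H: "z \<in> hyperbinary_expansions n" "y \<in> hyperbinary_expansions n"
    "w \<in> hyperbinary_expansions n"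
    using val P p' r ab unfolding hyperbinary_expansions_def
    by (auto simp: z_def y_def w_def)
  have sums: "sum_list w = Suc (sum_list z)" "sum_list z = Suc (sum_list x)"
    "sum_list y = Suc (sum_list x)"
    using child_digit_sum zx yx wz by auto
  then have ne: "w \<noteq> z" "w \<noteq> y" "w \<noteq> x" "z \<noteq> x" "y \<noteq> x" by auto
  let ?S = "mk_symmetric (with_proj (hyperbinary_graph n))"
  have arcs: "(w, z) \<in> parcs ?S" "(z, x) \<in> parcs ?S" "(x, y) \<in> parcs ?S" "(y, w) \<in> parcs ?S"
    using x in_H zx yx wz wy unfolding parcs_mk_symmetric by (force simp: hyperbinary_graph_def)+
  have "pre_digraph.cycle (with_proj ?S) [(w, z), (z, x), (x, y), (y, w)]"
    unfolding pre_digraph.cycle_def pre_digraph.awalk_def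
    using arcs ne zy in_H by (intro exI[of _ w]) (auto simp: hyperbinary_graph_def pre_digraph.cas.simps pre_digraph.awalk_verts.simps)
  then show ?thesis
    unfolding is_tree_def underlying_cycle_def by fastforce
qed

section \<open>Shapes of binary expansions\<close>

text \<open>The binary expansion is built by appending \<open>n mod 2\<close> to that of
  \<open>n div 2\<close>. The last two shapes contain the pattern 1 0 at most once.\<close>

lemma binary_expansion_cases:
  assumes "n \<ge> 1"
  shows "\<exists>x \<in> hyperbinary_expansions n. two_blocks x \<or>
    (\<exists>a b. a \<ge> 1 \<and> x = replicate a 1 @ replicate b 0) \<or>
    (\<exists>a b c. a \<ge> 1 \<and> b \<ge> 1 \<and> c \<ge> 1 \<and> x = replicate a 1 @ replicate b 0 @ replicate c 1)"
  using assms
proof (induction n rule: less_induct)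
  case (less n)
  show ?case
  proof (cases "n = 1")
    case True
    have "[1] \<in> hyperbinary_expansions n"
      using True by (simp add: hyperbinary_expansions_def word_value_Cons)
    moreover have "[1] = replicate 1 1 @ replicate 0 0" by simp
    ultimately show ?thesis by blast
  next
    case False
    then have "n div 2 < n" "n div 2 \<ge> 1" using less.prems by auto
    then obtain x where x: "x \<in> hyperbinary_expansions (n div 2)" and
      cases: "two_blocks x \<or>
        (\<exists>a b. a \<ge> 1 \<and> x = replicate a 1 @ replicate b 0) \<or>
        (\<exists>a b c. a \<ge> 1 \<and> b \<ge> 1 \<and> c \<ge> 1 \<and> x = replicate a 1 @ replicate b 0 @ replicate c 1)"
      using less.IH by blast
    define d where "d = n mod 2"
    have d: "d = 0 \<or> d = 1" unfolding d_def by auto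
    have "n = 2 * (n div 2) + d" by (simp add: d_def)
    then have xd: "x @ [d] \<in> hyperbinary_expansions n"
      using x d by (auto simp: hyperbinary_expansions_def)
    from cases show ?thesis
    proof (elim disjE exE conjE)
      assume "two_blocks x"
      then show ?thesis using xd two_blocks_append by blast
    next
      fix a b :: nat assume a: "a \<ge> 1" and xe: "x = replicate a 1 @ replicate b 0"
      consider "d = 0" | "d = 1" "b = 0" | "d = 1" "b \<ge> 1" using d by linarith
      then show ?thesis
      proof cases
        case 1
        then have "x @ [d] = replicate a 1 @ replicate (Suc b) 0"
          by (simp add: xe replicate_append_same)
        then show ?thesis using xd a by blast
      next
        case 2
        then have "x @ [d] = replicate (Suc a) 1 @ replicate 0 0"
          by (simp add: xe replicate_append_same)
        then show ?thesis using xd by (metis le_add1 plus_1_eq_Suc)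
      next
        case 3
        then have "x @ [d] = replicate a 1 @ replicate b 0 @ replicate 1 1"
          by (simp add: xe)
        then show ?thesis using xd a 3 by (metis order_refl)
      qed
    next
      fix a b c :: nat
      assume abc: "a \<ge> 1" "b \<ge> 1" "c \<ge> 1"
        and xe: "x = replicate a 1 @ replicate b 0 @ replicate c 1"
      show ?thesis
      proof (cases "d = 0")
        case True
        \<comment> \<open>The new 0 after the final run of ones completes a second block 1
          0.\<close>
        obtain a' b' c' where s: "a = Suc a'" "b = Suc b'" "c = Suc c'"
          using abc by (metis Suc_le_D One_nat_def)
        have "x @ [d] = replicate a' 1 @ [1, 0] @ (replicate b' 0 @ replicate c' 1) @ [1, 0] @ []"
          by (simp add: xe s True replicate_append_same flip: replicate_Suc)
        then have "two_blocks (x @ [d])" unfolding two_blocks_def by blast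
        then show ?thesis using xd by blast
      next
        case False
        then have "x @ [d] = replicate a 1 @ replicate b 0 @ replicate (Suc c) 1"
          using d by (simp add: xe replicate_append_same)
        then show ?thesis using xd abc by (metis le_SucI)
      qed
    qed
  qed
qed

lemma not_tree:
  assumes "m \<ge> 1" and no: "\<nexists>t \<epsilon> :: nat. t \<ge> 1 \<and> \<epsilon> \<in> {0, 1} \<and> m = 2 ^ t - \<epsilon>"
  shows "\<not> is_tree (with_proj (hyperbinary_graph (2 * m)))"
proof -
  have "\<exists>x \<in> hyperbinary_expansions (2 * m). two_blocks x"
  proof -
    obtain x where x: "x \<in> hyperbinary_expansions (2 * m)" and
      cases: "two_blocks x \<or>
        (\<exists>a b. a \<ge> 1 \<and> x = replicate a 1 @ replicate b 0) \<or>
        (\<exists>a b c. a \<ge> 1 \<and> b \<ge> 1 \<and> c \<ge> 1 \<and> x = replicate a 1 @ replicate b 0 @ replicate c 1)"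
      using binary_expansion_cases[of "2 * m"] assms(1) by fastforce
    have val: "word_value x = 2 * m" using x by (simp add: hyperbinary_expansions_def)
    from cases show ?thesis
    proof (elim disjE exE conjE)
      assume "two_blocks x"
      then show ?thesis using x by blast
    next
      fix a b c :: nat
      assume "c \<ge> 1" "x = replicate a 1 @ replicate b 0 @ replicate c 1"
      then have "x = (replicate a 1 @ replicate b 0 @ replicate (c - 1) 1) @ [1]"
        by (cases c) (simp_all add: replicate_append_same)
      then have "2 * m = 2 * word_value (replicate a 1 @ replicate b 0 @ replicate (c - 1) 1) + 1"
        using val word_value_snoc by metis
      then have False by presburger
      then show ?thesis ..
    next
      fix a b :: nat
      assume a: "a \<ge> 1" and xe: "x = replicate a 1 @ replicate b 0"
      have m: "2 * m = (2 ^ a - 1) * 2 ^ b"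
        using val unfolding xe word_value_append word_value_replicate_1 by simp
      have "b \<noteq> 0"
      proof
        assume "b = 0"
        moreover obtain a' where "a = Suc a'" using a by (cases a) auto
        ultimately have "2 * m = 2 * 2 ^ a' - 1" using m by simp
        moreover have "(2::nat) ^ a' \<ge> 1" by simp
        ultimately show False by presburger
      qed
      then obtain b' where b': "b = Suc b'" using not0_implies_Suc by blast
      have m': "m = (2 ^ a - 1) * 2 ^ b'" using m b' by simp
      \<comment> \<open>In \<open>m = (2 ^ a - 1) * 2 ^ b'\<close> the excluded forms are the
        degenerate ones: \<open>b' = 0\<close> is the case of epsilon 1, and \<open>a = 1\<close>
        that of epsilon 0.\<close>
      have "b' \<noteq> 0"
      proof
        assume "b' = 0"
        then have "m = 2 ^ a - 1" using m' by simp
        then show False using no a by blast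
      qed
      moreover have "a \<noteq> 1"
      proof
        assume "a = 1"
        then have "m = 2 ^ b' - 0" using m' by simp
        then show False using no \<open>b' \<noteq> 0\<close> by (metis One_nat_def Suc_leI insertI1 neq0_conv)
      qed
      ultimately obtain a2 b2 where s: "a = Suc (Suc a2)" "b = Suc (Suc b2)"
        using a b' by (metis One_nat_def Suc_le_D not0_implies_Suc)
      \<comment> \<open>Three digits 1 0 0 of \<open>x\<close> are rewritten as 0 2 0, of the same
        value 4; the preceding 1 and the new 0 form the first block, and 2 0 the second, with an
        empty gap.\<close>
      define y where "y = replicate a2 1 @ [1, 0] @ [] @ [2, 0] @ replicate b2 (0::nat)"
      have xs: "x = replicate a2 1 @ [1, 1, 0, 0] @ replicate b2 0"
        unfolding xe s by (simp add: replicate_app_Cons_same)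
      have "word_value y = word_value x"
        unfolding xs y_def by (simp add: word_value_append word_value_Cons)
      moreover have "hd y \<noteq> 0" by (cases a2) (auto simp: y_def)
      ultimately have "y \<in> hyperbinary_expansions (2 * m)"
        using val unfolding hyperbinary_expansions_def by (auto simp: y_def)
      moreover have "two_blocks y" unfolding two_blocks_def y_def by blast
      ultimately show ?thesis by blast
    qed
  qed
  then show ?thesis using two_blocks_not_tree by blast
qed

theorem theorem5p4:
  fixes m :: nat
  assumes "m \<ge> 1"
  shows "is_tree (with_proj (hyperbinary_graph (2 * m))) \<longleftrightarrow>
    (\<exists>t \<epsilon> :: nat. t \<ge> 1 \<and> \<epsilon> \<in> {0, 1} \<and> m = 2 ^ t - \<epsilon>)"
proof
  assume "\<exists>t \<epsilon> :: nat. t \<ge> 1 \<and> \<epsilon> \<in> {0, 1} \<and> m = 2 ^ t - \<epsilon>"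
  then obtain t where "m = 2 ^ t \<or> m = 2 ^ t - 1"
    by (metis diff_zero insertE empty_iff)
  then have "2 * m = 2 ^ Suc t \<or> 2 * m = 2 ^ Suc t - 2" by auto
  then show "is_tree (with_proj (hyperbinary_graph (2 * m)))"
    using is_tree_pow2[of "Suc t"] is_tree_pow2_minus_2[of t] by metis
qed (use not_tree[OF assms] in blast)

end
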